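(* For every integer $k \geq 1$, as formal power series in $q$, \[ \sum_{n = 0}^\infty \left(\sum_{\substack{\pi \in \mathcal{D}(n) \\ \#(\pi) \geq k}} (-1)^{\# (\pi)} (s_k (\pi) - s_{k - 1} (\pi))\right) q^n = (-1)^{k - 1} q^{k(k - 1)/2} \sum_{n = k}^\infty \begin{bmatrix} n-1 \\ k-1\end{bmatrix}_q \big((q^n; q)_\infty - 1\big). \]
   Context: $\mathcal{D}(n)$ denotes the set of partitions of $n$ into distinct parts; for $\pi \in \mathcal{D}(n)$, $\#(\pi)$ is the number of parts and $s_j(\pi)$ is the $j$th smallest part, with the convention $s_0(\pi)=0$. Here $(a;q)_\infty=\prod_{i\ge0}(1-aq^i)$, $(q;q)_n=(1-q)\cdots(1-q^n)$, and $\begin{bmatrix} n \\ r\end{bmatrix}_q = \frac{(q;q)_n}{(q;q)_r (q;q)_{n-r}}$ for $n\ge r\ge0$, $0$ for $n<r$. *)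

theory Defs
  imports "HOL-Analysis.Analysis" "HOL-Computational_Algebra.Formal_Power_Series"
begin

text \<open>
  A partition into distinct parts is encoded as the finite set of its (positive) parts; its number
  of parts is then its cardinality.
\<close>

definition distinct_partitions :: "nat \<Rightarrow> nat set set" where
  "distinct_partitions n = {\<pi>. finite \<pi> \<and> 0 \<notin> \<pi> \<and> \<Sum>\<pi> = n}"

lemma finite_distinct_partitions: "finite (distinct_partitions n)"
proof (rule finite_subset)
  show "distinct_partitions n \<subseteq> Pow {..n}"
    unfolding distinct_partitions_def by (auto intro: member_le_sum[where f = "\<lambda>x. x", simplified])
qed simp

text \<open>
  The \<open>j\<close>-th smallest part, with the convention that the \<open>0\<close>-th one is \<open>0\<close>; only meaningful for
  \<open>j \<le> card \<pi>\<close>.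
\<close>

definition smallest_part :: "nat \<Rightarrow> nat set \<Rightarrow> nat" where
  "smallest_part j \<pi> = (0 # sorted_list_of_set \<pi>) ! j"

text \<open>
  The infinite product \<open>(a; q)\<^sub>\<infinity>\<close>, taken in the \<open>q\<close>-adic topology on formal power series.
  The coefficients are real rather than integral: the quotient defining the \<open>q\<close>-binomial
  coefficient needs a field, and the library's lemmas on infinite products of power series
  ask for a topological coefficient type (which does not affect the topology on the series).
\<close>

definition qpochhammer_inf :: "real fps \<Rightarrow> real fps \<Rightarrow> real fps" where
  "qpochhammer_inf a q = (\<Prod>i. 1 - a * q ^ i)"

lemma convergent_prod_qpochhammer_inf:
  assumes "n > 0"
  shows "convergent_prod (\<lambda>i. 1 - fps_X ^ n * fps_X ^ i :: real fps)"
proof -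
  let ?f = "\<lambda>i. 1 - fps_X ^ n * fps_X ^ i :: real fps"
  have nth0: "fps_nth (?f i) 0 = 1" for i
    using assms by (simp flip: power_add)
  have nz: "?f i \<noteq> 0" for i
    using nth0[of i] by (metis fps_zero_nth zero_neq_one)
  have sd: "subdegree (?f i - 1) > m" if "i > m" for m i
  proof -
    have "subdegree (?f i - 1) = subdegree (fps_X ^ (n + i) :: real fps)"
      by (simp add: power_add)
    thus ?thesis using that by simp
  qed
  obtain P where P: "(\<lambda>N. \<Prod>i\<le>N. ?f i) \<longlonglongrightarrow> P"
    using tendsto_prod_fps[of ?f "\<lambda>m. m"] nz sd by blast
  have "eventually (\<lambda>N. fps_nth (\<Prod>i\<le>N. ?f i) 0 = fps_nth P 0) at_top"
    using P unfolding tendsto_fps_iff by blast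
  moreover have "fps_nth (\<Prod>i\<le>N. ?f i) 0 = 1" for N
    by (induction N) (simp_all only: atMost_0 prod.insert prod.empty prod.atMost_Suc fps_mult_nth_0 nth0
        finite.emptyI empty_iff not_False_eq_True mult_1_right)
  ultimately have "P \<noteq> 0" by auto
  thus ?thesis
    using P unfolding convergent_prod_def raw_has_prod_def by (intro exI[of _ 0] exI[of _ P]) simp
qed

text \<open>The finite product \<open>(q; q)\<^sub>n\<close>.\<close>

definition qpochhammer_fin :: "real fps \<Rightarrow> nat \<Rightarrow> real fps" where
  "qpochhammer_fin q n = (\<Prod>i = 1..n. 1 - q ^ i)"

definition qbinomial :: "real fps \<Rightarrow> nat \<Rightarrow> nat \<Rightarrow> real fps" where
  "qbinomial q n r =
     (if r \<le> n then qpochhammer_fin q n / (qpochhammer_fin q r * qpochhammer_fin q (n - r)) else 0)"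

end

theory Submission
  imports Defs
begin

unbundle no vec_syntax and fps_syntax

text \<open>
  The difference \<open>s\<^sub>k(\<pi>) - s\<^bsub>k-1\<^esub>(\<pi>)\<close> counts the \<open>m\<close> for which exactly \<open>k - 1\<close> parts of \<open>\<pi>\<close> are
  smaller than \<open>m\<close>. For fixed \<open>m\<close>, such a \<open>\<pi>\<close> with at least \<open>k\<close> parts splits uniquely into a
  \<open>(k-1)\<close>-subset of \<open>{1..<m}\<close>, with generating function \<open>q\<^bsup>k(k-1)/2\<^esup>\<close> times a \<open>q\<close>-binomial coefficient,
  and a nonempty set of parts \<open>\<ge> m\<close>, with signed generating function \<open>(q\<^sup>m; q)\<^sub>\<infinity> - 1\<close>.
\<close>

section \<open>The q-Pascal rule for q-binomial coefficients\<close>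

lemma qpochhammer_fin_Suc:
  "qpochhammer_fin q (Suc n) = qpochhammer_fin q n * (1 - q ^ Suc n)"
  by (simp add: qpochhammer_fin_def mult.commute)

lemma qpochhammer_fin_fps_X_nth_0: "qpochhammer_fin fps_X n $ 0 = 1"
  by (induction n) (simp_all add: qpochhammer_fin_Suc, simp add: qpochhammer_fin_def)

lemma qpochhammer_fin_fps_X_nonzero: "qpochhammer_fin fps_X n \<noteq> 0"
  using qpochhammer_fin_fps_X_nth_0[of n] by auto

text \<open>Constant term 1 makes the denominator a unit, so the division is exact. Identities
  between q-binomial coefficients can then be proved by clearing denominators.\<close>

lemma qbinomial_mult_qpochhammer_fin:
  assumes "r \<le> n"
  shows "qbinomial fps_X n r * (qpochhammer_fin fps_X r * qpochhammer_fin fps_X (n - r)) =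
    qpochhammer_fin fps_X n"
proof -
  let ?d = "qpochhammer_fin fps_X r * qpochhammer_fin fps_X (n - r)"
  have "?d $ 0 \<noteq> 0"
    by (simp add: qpochhammer_fin_fps_X_nth_0)
  then show ?thesis
    using assms unfolding qbinomial_def
    by (simp add: fps_divide_unit mult.assoc inverse_mult_eq_1)
qed

lemma qbinomial_0_right: "qbinomial fps_X n 0 = 1"
  using qbinomial_mult_qpochhammer_fin[of 0 n] qpochhammer_fin_fps_X_nonzero[of n]
  by (simp add: qpochhammer_fin_def)

lemma qbinomial_refl: "qbinomial fps_X n n = 1"
  using qbinomial_mult_qpochhammer_fin[of n n] qpochhammer_fin_fps_X_nonzero[of n]
  by (simp add: qpochhammer_fin_def)

text \<open>Over a common denominator this reduces to
  \<open>(1 - q^(n-r)) + q^(n-r) * (1 - q^(r+1)) = 1 - q^(n+1)\<close>.\<close>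

lemma qbinomial_Suc_Suc:
  assumes "r \<le> n"
  shows "qbinomial fps_X (Suc n) (Suc r) =
    qbinomial fps_X n (Suc r) + fps_X ^ (n - r) * qbinomial fps_X n r"
proof (cases "r = n")
  case True
  \<comment> \<open>Here \<open>qbinomial fps_X n (Suc n)\<close> takes its out-of-range value 0,
    and the power of q is 1.\<close>
  then show ?thesis
    by (simp add: qbinomial_refl) (simp add: qbinomial_def)
next
  case False
  let ?Q = "qpochhammer_fin fps_X"
  \<comment> \<open>Writing \<open>n - r\<close> as \<open>Suc d\<close> lets the recursion of the
    finite products apply without truncated subtraction.\<close>
  from False assms obtain d where n: "n = Suc (r + d)"
    by (metis add_Suc_right le_neq_implies_less less_imp_Suc_add)
  have 1: "qbinomial fps_X (Suc n) (Suc r) * (?Q (Suc r) * ?Q (Suc d)) = ?Q (Suc n)"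
    using qbinomial_mult_qpochhammer_fin[of "Suc r" "Suc n"] n by simp
  have 2: "qbinomial fps_X n (Suc r) * (?Q (Suc r) * ?Q d) = ?Q n"
    using qbinomial_mult_qpochhammer_fin[of "Suc r" n] n by simp
  have 3: "qbinomial fps_X n r * (?Q r * ?Q (Suc d)) = ?Q n"
    using qbinomial_mult_qpochhammer_fin[of r n] n by simp
  have "(qbinomial fps_X n (Suc r) + fps_X ^ (n - r) * qbinomial fps_X n r) *
      (?Q (Suc r) * ?Q (Suc d)) =
    (qbinomial fps_X n (Suc r) * (?Q (Suc r) * ?Q d)) * (1 - fps_X ^ Suc d) +
    fps_X ^ Suc d * (qbinomial fps_X n r * (?Q r * ?Q (Suc d))) * (1 - fps_X ^ Suc r)"
    by (simp only: qpochhammer_fin_Suc n) (simp add: algebra_simps)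
  also have "\<dots> = ?Q n * (1 - fps_X ^ Suc n)"
    unfolding 2 3 by (simp add: n algebra_simps power_add)
  also have "\<dots> = qbinomial fps_X (Suc n) (Suc r) * (?Q (Suc r) * ?Q (Suc d))"
    unfolding 1 by (simp only: qpochhammer_fin_Suc)
  finally show ?thesis
    using qpochhammer_fin_fps_X_nonzero by (metis mult_right_cancel no_zero_divisors)
qed

section \<open>The generating function of the r-subsets of \<open>{1..n}\<close>\<close>

text \<open>Separating the subsets by whether they contain the largest element \<open>Suc n\<close>
  reproduces the two terms of the q-Pascal rule. The power of q in front is the weight of the
  lightest subset \<open>{1..r}\<close>.\<close>

lemma sum_subsets_eq_qbinomial:
  "(\<Sum>A | A \<subseteq> {1..n} \<and> card A = r. fps_X ^ \<Sum>A) =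
    fps_X ^ (r * (r + 1) div 2) * qbinomial fps_X n r"
proof (induction n arbitrary: r)
  case 0
  have "{A. A \<subseteq> {1..0::nat} \<and> card A = r} = (if r = 0 then {{}} else {})"
    by auto
  then show ?case
    by (simp add: qbinomial_0_right) (simp add: qbinomial_def)
next
  case (Suc n)
  show ?case
  proof (cases r)
    case 0
    have "{A. A \<subseteq> {1..Suc n} \<and> card A = 0} = {{}}"
      by (auto dest: finite_subset)
    then show ?thesis
      using 0 by (simp add: qbinomial_0_right)
  next
    case r: (Suc s)
    let ?S = "\<lambda>n r. {A. A \<subseteq> {1..n} \<and> card A = r} :: nat set set"
    have fin: "finite (?S n r)" for n r
      by (rule finite_subset[of _ "Pow {1..n}"]) auto
    have split: "?S (Suc n) (Suc s) = ?S n (Suc s) \<union> insert (Suc n) ` ?S n s"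
    proof (intro equalityI subsetI)
      fix A assume A: "A \<in> ?S (Suc n) (Suc s)"
      then have finA: "finite A"
        by (auto dest: finite_subset)
      show "A \<in> ?S n (Suc s) \<union> insert (Suc n) ` ?S n s"
      proof (cases "Suc n \<in> A")
        case True
        have "A - {Suc n} \<in> ?S n s"
          using A True finA by (auto simp: card_Diff_singleton le_Suc_eq)
        moreover have "A = insert (Suc n) (A - {Suc n})"
          using True by auto
        ultimately show ?thesis
          by blast
      next
        case False
        then show ?thesis
          using A by (auto simp: le_Suc_eq subset_iff)
      qed
    next
      fix A assume "A \<in> ?S n (Suc s) \<union> insert (Suc n) ` ?S n s"
      then show "A \<in> ?S (Suc n) (Suc s)"
      proof
        assume "A \<in> insert (Suc n) ` ?S n s"
        then obtain B where B: "B \<subseteq> {1..n}" "card B = s" "A = insert (Suc n) B"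
          by auto
        moreover have "finite B" "Suc n \<notin> B"
          using B(1) by (auto dest: finite_subset)
        ultimately show ?thesis
          by auto
      qed auto
    qed
    have "(\<Sum>A\<in>?S (Suc n) (Suc s). fps_X ^ \<Sum>A :: real fps) =
      (\<Sum>A\<in>?S n (Suc s). fps_X ^ \<Sum>A) + (\<Sum>A\<in>insert (Suc n) ` ?S n s. fps_X ^ \<Sum>A)"
      unfolding split by (rule sum.union_disjoint) (use fin in auto)
    also have "(\<Sum>A\<in>insert (Suc n) ` ?S n s. fps_X ^ \<Sum>A :: real fps) =
      (\<Sum>A\<in>?S n s. fps_X ^ \<Sum>(insert (Suc n) A))"
    proof (subst sum.reindex)
      show "inj_on (insert (Suc n)) (?S n s)"
        by (rule inj_onI) (metis (no_types, lifting) mem_Collect_eq insert_ident atLeastAtMost_iff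
            Suc_n_not_le_n subsetD)
    qed simp
    also have "\<dots> = (\<Sum>A\<in>?S n s. fps_X ^ Suc n * fps_X ^ \<Sum>A)"
    proof (rule sum.cong)
      fix A assume "A \<in> ?S n s"
      then have "finite A" "Suc n \<notin> A"
        by (auto dest: finite_subset)
      then show "fps_X ^ \<Sum>(insert (Suc n) A) = (fps_X ^ Suc n * fps_X ^ \<Sum>A :: real fps)"
        by (simp add: power_add)
    qed simp
    also have "\<dots> = fps_X ^ Suc n * (fps_X ^ (s * (s + 1) div 2) * qbinomial fps_X n s)"
      unfolding sum_distrib_left[symmetric] Suc.IH by simp
    also have "(\<Sum>A\<in>?S n (Suc s). fps_X ^ \<Sum>A :: real fps) =
      fps_X ^ (Suc s * (Suc s + 1) div 2) * qbinomial fps_X n (Suc s)"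
      by (rule Suc.IH)
    finally have eq: "(\<Sum>A\<in>?S (Suc n) (Suc s). fps_X ^ \<Sum>A :: real fps) =
      fps_X ^ (Suc s * (Suc s + 1) div 2) * qbinomial fps_X n (Suc s) +
      fps_X ^ Suc n * (fps_X ^ (s * (s + 1) div 2) * qbinomial fps_X n s)" .
    have tri: "Suc s * (Suc s + 1) div 2 = s * (s + 1) div 2 + Suc s"
      by simp
    show ?thesis
    proof (cases "s \<le> n")
      case True
      have "fps_X ^ Suc n * (fps_X ^ (s * (s + 1) div 2) * qbinomial fps_X n s) =
        fps_X ^ (Suc s * (Suc s + 1) div 2) * (fps_X ^ (n - s) * qbinomial fps_X n s)"
      proof -
        \<comment> \<open>Raising the triangular exponent from s to \<open>Suc s\<close> uses up
          \<open>Suc s\<close> of the weight \<open>Suc n\<close>; the remaining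
          \<open>n - s\<close> is the exponent in the q-Pascal rule.\<close>
        have "Suc n + s * (s + 1) div 2 = Suc s * (Suc s + 1) div 2 + (n - s)"
          using True unfolding tri by simp
        then show ?thesis
          by (metis mult.assoc power_add)
      qed
      then show ?thesis
        unfolding r eq by (simp only: qbinomial_Suc_Suc[OF True] distrib_left)
    next
      case False
      \<comment> \<open>For s > n all three q-binomial coefficients are out of range, hence
        0.\<close>
      then show ?thesis
        unfolding r eq by (simp add: qbinomial_def)
    qed
  qed
qed

section \<open>Coefficients of the infinite product\<close>

text \<open>Multiplying by the factor with index j changes a series by a multiple of q^j, so factors
  beyond N leave coefficients up to N alone.\<close>

lemma prod_one_minus_fps_X_nth_cong:
  assumes "i \<le> N" "N \<le> M"
  shows "(\<Prod>j\<in>{m..M}. 1 - fps_X ^ j :: real fps) $ i = (\<Prod>j\<in>{m..N}. 1 - fps_X ^ j) $ i"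
  using assms(2)
proof (induction M rule: dec_induct)
  case (step M)
  show ?case
  proof (cases "m \<le> Suc M")
    case True
    have "(\<Prod>j\<in>{m..Suc M}. 1 - fps_X ^ j :: real fps) =
      (\<Prod>j\<in>{m..M}. 1 - fps_X ^ j) - fps_X ^ Suc M * (\<Prod>j\<in>{m..M}. 1 - fps_X ^ j)"
      using True by (simp add: atLeastAtMostSuc_conv algebra_simps)
    then show ?thesis
      using step assms(1) by (simp add: fps_X_power_mult_nth del: power_Suc)
  next
    case False
    then show ?thesis
      using step by simp
  qed
qed simp

lemma qpochhammer_inf_fps_X_nth:
  assumes "m > 0" "i \<le> N"
  shows "qpochhammer_inf (fps_X ^ m) fps_X $ i = (\<Prod>j\<in>{m..N}. 1 - fps_X ^ j) $ i"
proof -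
  let ?f = "\<lambda>i. 1 - fps_X ^ m * fps_X ^ i :: real fps"
  \<comment> \<open>The limit is read off diagonally: its i-th coefficient has settled once the
    product reaches index i.\<close>
  define P where "P = Abs_fps (\<lambda>i. (\<Prod>j\<in>{m..i}. 1 - fps_X ^ j :: real fps) $ i)"
  have partial: "(\<Prod>i\<le>M. ?f i) = (\<Prod>j\<in>{m..m + M}. 1 - fps_X ^ j)" for M
    by (rule prod.reindex_bij_witness[of _ "\<lambda>j. j - m" "\<lambda>i. m + i"]) (auto simp: power_add)
  have "(\<lambda>M. \<Prod>i\<le>M. ?f i) \<longlonglongrightarrow> P"
    unfolding tendsto_fps_iff
  proof
    fix i
    show "eventually (\<lambda>M. (\<Prod>i\<le>M. ?f i) $ i = P $ i) sequentially"
      using eventually_ge_at_top[of i]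
    proof eventually_elim
      case (elim M)
      then show ?case
        unfolding partial P_def fps_nth_Abs_fps
        by (intro prod_one_minus_fps_X_nth_cong) simp_all
    qed
  qed
  \<comment> \<open>\<open>has_prod\<close> demands a nonzero limit. As m > 0, the range
    \<open>{m..0}\<close> is empty and the constant term is 1.\<close>
  moreover have "P $ 0 = 1"
    using assms(1) by (simp add: P_def)
  then have "P \<noteq> 0"
    by auto
  ultimately have "?f has_prod P"
    by (simp add: has_prod_def raw_has_prod_def)
  then have "qpochhammer_inf (fps_X ^ m) fps_X = P"
    unfolding qpochhammer_inf_def by (rule has_prod_unique[symmetric])
  then show ?thesis
    using prod_one_minus_fps_X_nth_cong[OF order.refl assms(2), of m] by (simp add: P_def)
qed

section \<open>Signed sets of parts and their splitting at m\<close>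

text \<open>Expanding the product picks 1 or -q^j from each factor; B records the j of the second
  choice.\<close>

lemma prod_one_minus_fps_X_eq_sum_subsets:
  assumes "finite S"
  shows "(\<Prod>j\<in>S. 1 - fps_X ^ j :: real fps) = (\<Sum>B\<in>Pow S. (- 1) ^ card B * fps_X ^ \<Sum>B)"
  using assms
proof (induction S)
  case (insert x S)
  have "(\<Sum>B\<in>Pow (insert x S). (- 1) ^ card B * fps_X ^ \<Sum>B :: real fps) =
    (\<Sum>B\<in>Pow S. (- 1) ^ card B * fps_X ^ \<Sum>B) +
    (\<Sum>B\<in>insert x ` Pow S. (- 1) ^ card B * fps_X ^ \<Sum>B)"
    unfolding Pow_insert by (rule sum.union_disjoint) (use insert in auto)
  also have "(\<Sum>B\<in>insert x ` Pow S. (- 1) ^ card B * fps_X ^ \<Sum>B :: real fps) =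
    (\<Sum>B\<in>Pow S. (- 1) ^ card (insert x B) * fps_X ^ \<Sum>(insert x B))"
  proof (subst sum.reindex)
    show "inj_on (insert x) (Pow S)"
      using insert by (intro inj_onI) (metis PowD insert_ident subsetD)
  qed simp
  also have "\<dots> = (\<Sum>B\<in>Pow S. - (fps_X ^ x) * ((- 1) ^ card B * fps_X ^ \<Sum>B))"
  proof (rule sum.cong)
    fix B assume "B \<in> Pow S"
    then have "finite B" "x \<notin> B"
      using insert by (auto dest: finite_subset)
    then show "(- 1) ^ card (insert x B) * fps_X ^ \<Sum>(insert x B) =
        - (fps_X ^ x) * ((- 1) ^ card B * fps_X ^ \<Sum>B :: real fps)"
      by (simp add: power_add algebra_simps)
  qed simp
  also have "\<dots> = - (fps_X ^ x) * (\<Prod>j\<in>S. 1 - fps_X ^ j)"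
    by (simp only: sum_distrib_left insert.IH)
  finally show ?case
    using insert by (simp add: algebra_simps)
qed simp

text \<open>
  The condition \<open>k \<le> card \<pi>\<close> says that \<open>\<pi>\<close> has a part \<open>\<ge> m\<close>, which is what the subtraction
  of \<open>1\<close> enforces.
\<close>

lemma sum_split_at:
  assumes "m > 0" "k > 0"
  shows "(\<Sum>A | A \<subseteq> {1..m - 1} \<and> card A = k - 1. fps_X ^ \<Sum>A) *
      ((\<Prod>j\<in>{m..N}. 1 - fps_X ^ j) - 1 :: real fps) * (- 1) ^ (k - 1) =
    (\<Sum>\<pi> | \<pi> \<subseteq> {1..max N (m - 1)} \<and> k \<le> card \<pi> \<and> card {x \<in> \<pi>. x < m} = k - 1.
      (- 1) ^ card \<pi> * fps_X ^ \<Sum>\<pi>)"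
    (is "?L = (\<Sum>\<pi>\<in>?R. _)")
proof -
  let ?A = "{A. A \<subseteq> {1..m - 1} \<and> card A = k - 1}"
  let ?B = "Pow {m..N} - {{}}"
  have "(\<Prod>j\<in>{m..N}. 1 - fps_X ^ j :: real fps) - 1 = (\<Sum>B\<in>?B. (- 1) ^ card B * fps_X ^ \<Sum>B)"
    by (simp add: prod_one_minus_fps_X_eq_sum_subsets sum_diff1)
  then have "?L = (\<Sum>(A, B)\<in>?A \<times> ?B.
      fps_X ^ \<Sum>A * ((- 1) ^ card B * fps_X ^ \<Sum>B) * (- 1) ^ (k - 1))"
    by (simp only: sum_product) (simp only: sum_distrib_right, simp only: sum.cartesian_product)
  also have "\<dots> = (\<Sum>\<pi>\<in>?R. (- 1) ^ card \<pi> * fps_X ^ \<Sum>\<pi>)"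
  \<comment> \<open>A pair (A, B) is glued by union and recovered by cutting at m.\<close>
  proof (rule sum.reindex_bij_witness
      [of _ "\<lambda>\<pi>. ({x \<in> \<pi>. x < m}, {x \<in> \<pi>. m \<le> x})" "\<lambda>(A, B). A \<union> B"], goal_cases)
    case (1 p)
    obtain A B where p: "p = (A, B)"
      by fastforce
    have "A \<subseteq> {1..m - 1}" "B \<subseteq> {m..N}"
      using 1 p by auto
    then have "{x \<in> A \<union> B. x < m} = A" "{x \<in> A \<union> B. m \<le> x} = B"
      using assms by (fastforce simp: subset_iff)+
    then show ?case
      by (simp add: p)
  next
    case (2 p)
    obtain A B where p: "p = (A, B)"
      by fastforce
    have AB: "A \<subseteq> {1..m - 1}" "B \<subseteq> {m..N}" "card A = k - 1" "B \<noteq> {}"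
      using 2 p by auto
    then have "{x \<in> A \<union> B. x < m} = A" "A \<inter> B = {}"
      using assms by (fastforce simp: subset_iff)+
    moreover have fin: "finite A" "finite B"
      using AB by (auto dest: finite_subset)
    moreover have "card B > 0"
      using AB fin by (simp add: card_gt_0_iff)
    \<comment> \<open>The maximum covers the case m - 1 > N, where A may reach beyond N.\<close>
    moreover have "A \<union> B \<subseteq> {1..max N (m - 1)}"
      using AB assms by (fastforce simp: subset_iff)
    ultimately show ?case
      using AB by (simp add: p card_Un_disjoint)
  next
    case (3 \<pi>)
    then show ?case
      by auto
  next
    case (4 \<pi>)
    \<comment> \<open>Otherwise all parts, at least k of them, would lie below m, where there are
      only k - 1.\<close>
    have "{x \<in> \<pi>. m \<le> x} \<noteq> {}"
    proof
      assume "{x \<in> \<pi>. m \<le> x} = {}"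
      then have "{x \<in> \<pi>. x < m} = \<pi>"
        by (auto simp: not_le)
      then show False
        using 4 assms by auto
    qed
    then show ?case
      using 4 assms by (auto simp: subset_iff le_max_iff_disj)
  next
    case (5 p)
    obtain A B where p: "p = (A, B)"
      by fastforce
    have AB: "A \<subseteq> {1..m - 1}" "B \<subseteq> {m..N}" "card A = k - 1"
      using 5 p by auto
    then have "A \<inter> B = {}"
      using assms by (fastforce simp: subset_iff)
    moreover have "finite A" "finite B"
      using AB by (auto dest: finite_subset)
    \<comment> \<open>As A has k - 1 elements, the factor \<open>(- 1) ^ (k - 1)\<close> is its
      share of the sign of the union.\<close>
    ultimately show ?case
      using AB by (simp add: p card_Un_disjoint sum.union_disjoint power_add algebra_simps)
  qed
  finally show ?thesis .
qed

section \<open>Gaps between consecutive parts as numbers of cut points\<close>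

text \<open>In a strictly increasing list the entries below m form an initial segment, so there are
  k of them exactly when index k - 1 is the last one inside.\<close>

lemma card_less_eq_iff_nth:
  fixes ys :: "nat list"
  assumes ys: "sorted_wrt (<) ys" and k: "0 < k" "k < length ys"
  shows "card {x \<in> set ys. x < m} = k \<longleftrightarrow> ys ! (k - 1) < m \<and> m \<le> ys ! k"
proof -
  have mono: "ys ! i < ys ! j \<longleftrightarrow> i < j" if "i < length ys" "j < length ys" for i j
    using sorted_wrt_nth_less[OF ys, of i j] sorted_wrt_nth_less[OF ys, of j i] that
    by (cases i j rule: linorder_cases) auto
  let ?I = "{i. i < length ys \<and> ys ! i < m}"
  have "{x \<in> set ys. x < m} = (!) ys ` ?I"
    by (auto simp: in_set_conv_nth)
  moreover have "inj_on ((!) ys) ?I"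
    using ys by (auto simp: inj_on_def nth_eq_iff_index_eq strict_sorted_iff)
  ultimately have card_eq: "card {x \<in> set ys. x < m} = card ?I"
    by (simp add: card_image)
  \<comment> \<open>Too low an m leaves at most k - 1 entries below it, too high an m at least k +
    1.\<close>
  consider (low) "m \<le> ys ! (k - 1)" | (mid) "ys ! (k - 1) < m" "m \<le> ys ! k" | (high) "ys ! k < m"
    by linarith
  then show ?thesis
  proof cases
    case low
    have "?I \<subseteq> {..<k - 1}"
    proof
      fix i assume "i \<in> ?I"
      then have "ys ! i < ys ! (k - 1)" "i < length ys"
        using low by auto
      then show "i \<in> {..<k - 1}"
        using mono[of i "k - 1"] k by simp
    qed
    then have "card ?I \<le> k - 1"
      using card_mono[of "{..<k - 1}" ?I] by simp
    then show ?thesis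
      unfolding card_eq using low k by simp
  next
    case mid
    have "?I = {..<k}"
    proof (intro equalityI subsetI)
      fix i assume "i \<in> ?I"
      then have "ys ! i < ys ! k" "i < length ys"
        using mid by auto
      then show "i \<in> {..<k}"
        using mono[of i k] k by simp
    next
      fix i assume i: "i \<in> {..<k}"
      then have "ys ! i \<le> ys ! (k - 1)"
        using mono[of "k - 1" i] k by (simp add: not_less[symmetric])
      then show "i \<in> ?I"
        using i mid k by simp
    qed
    then show ?thesis
      unfolding card_eq using mid by simp
  next
    case high
    have "{..k} \<subseteq> ?I"
    proof
      fix i assume i: "i \<in> {..k}"
      then have "ys ! i \<le> ys ! k"
        using mono[of k i] k by (simp add: not_less[symmetric])
      then show "i \<in> ?I"
        using i high k by simp
    qed
    then have "Suc k \<le> card ?I"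
      using card_mono[of ?I "{..k}"] by simp
    then show ?thesis
      unfolding card_eq using high by simp
  qed
qed

text \<open>Prepending 0 realises the convention for the 0th part and raises the count below a
  positive m by one, so k = 1 needs no separate treatment. For m = 0 both sides are false.\<close>

lemma card_parts_less_eq_iff:
  assumes "finite \<pi>" "0 \<notin> \<pi>" "0 < k" "k \<le> card \<pi>"
  shows "0 < m \<and> card {x \<in> \<pi>. x < m} = k - 1 \<longleftrightarrow>
    smallest_part (k - 1) \<pi> < m \<and> m \<le> smallest_part k \<pi>"
proof (cases "m = 0")
  case False
  let ?ys = "0 # sorted_list_of_set \<pi>"
  have "sorted_wrt (<) ?ys"
    using assms by (auto simp: strict_sorted_iff intro: gr0I)
  then have "card {x \<in> set ?ys. x < m} = k \<longleftrightarrow> ?ys ! (k - 1) < m \<and> m \<le> ?ys ! k"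
    using assms by (intro card_less_eq_iff_nth) auto
  moreover have "{x \<in> set ?ys. x < m} = insert 0 {x \<in> \<pi>. x < m}"
    using False assms by auto
  moreover have "card (insert 0 {x \<in> \<pi>. x < m}) = Suc (card {x \<in> \<pi>. x < m})"
    using assms by (subst card_insert_disjoint) auto
  ultimately show ?thesis
    using False assms(3) unfolding smallest_part_def by simp linarith
qed simp

text \<open>The gap is the number of m in the half-open interval between the two parts. These m are
  written as \<open>n + k\<close> to match the index of the series.\<close>

lemma smallest_part_diff_eq_card:
  assumes "\<pi> \<subseteq> {1..N}" "0 < k" "k \<le> card \<pi>"
  shows "real (smallest_part k \<pi>) - real (smallest_part (k - 1) \<pi>) =
    real (card {n \<in> {..N}. card {x \<in> \<pi>. x < n + k} = k - 1})"
proof -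
  let ?s = "\<lambda>j. smallest_part j \<pi>"
  have fin: "finite \<pi>" and nz: "0 \<notin> \<pi>"
    using assms by (auto dest: finite_subset)
  note iff = card_parts_less_eq_iff[OF fin nz assms(2,3)]
  have "?s k \<in> \<pi>"
  proof -
    have "?s k = sorted_list_of_set \<pi> ! (k - 1)"
      using assms by (simp add: smallest_part_def nth_Cons')
    moreover have "sorted_list_of_set \<pi> ! (k - 1) \<in> set (sorted_list_of_set \<pi>)"
      using assms fin by (intro nth_mem) auto
    ultimately show ?thesis
      using fin by simp
  qed
  then have sN: "?s k \<le> N"
    using assms by auto
  \<comment> \<open>Having k - 1 distinct positive parts below m forces m - 1 \<ge> k - 1, so the
    shift by k loses no cut point.\<close>
  have ge_k: "k \<le> m" if "card {x \<in> \<pi>. x < m} = k - 1" "0 < m" for m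
  proof -
    have "card {x \<in> \<pi>. x < m} \<le> card {1..<m}"
      using nz by (intro card_mono) (auto simp: Suc_le_eq intro!: Nat.gr0I)
    then show ?thesis
      using that by simp
  qed
  have "{?s (k - 1)<..?s k} = (\<lambda>n. n + k) ` {n \<in> {..N}. card {x \<in> \<pi>. x < n + k} = k - 1}"
  proof (intro equalityI subsetI)
    fix m assume m: "m \<in> {?s (k - 1)<..?s k}"
    then have *: "0 < m" "card {x \<in> \<pi>. x < m} = k - 1"
      using iff[of m] by auto
    then have "k \<le> m"
      using ge_k by blast
    then show "m \<in> (\<lambda>n. n + k) ` {n \<in> {..N}. card {x \<in> \<pi>. x < n + k} = k - 1}"
      using * m sN by (intro image_eqI[of _ _ "m - k"]) auto
  next
    fix m assume "m \<in> (\<lambda>n. n + k) ` {n \<in> {..N}. card {x \<in> \<pi>. x < n + k} = k - 1}"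
    then show "m \<in> {?s (k - 1)<..?s k}"
      using iff[of m] assms by auto
  qed
  then have "card {?s (k - 1)<..?s k} = card {n \<in> {..N}. card {x \<in> \<pi>. x < n + k} = k - 1}"
    by (simp add: card_image)
  \<comment> \<open>Monotonicity makes the truncated difference of naturals agree with the real
    one.\<close>
  moreover have "?s (k - 1) \<le> ?s k"
  proof -
    have "sorted (0 # sorted_list_of_set \<pi>)"
      by simp
    then show ?thesis
      unfolding smallest_part_def using assms by (intro sorted_nth_mono) auto
  qed
  ultimately show ?thesis
    by (simp add: of_nat_diff[symmetric])
qed

section \<open>Coefficientwise summation and comparison of coefficients\<close>

text \<open>Only the terms with n \<le> i reach coefficient i, so it is constant from some partial
  sum on.\<close>

lemma fps_sums_nth:
  fixes F :: "nat \<Rightarrow> real fps"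
  assumes "\<And>n i. i < n \<Longrightarrow> F n $ i = 0"
  shows "F sums Abs_fps (\<lambda>i. (\<Sum>n\<le>i. F n $ i))"
  unfolding sums_def tendsto_fps_iff
proof
  fix i
  show "eventually (\<lambda>M. (\<Sum>n<M. F n) $ i = Abs_fps (\<lambda>i. (\<Sum>n\<le>i. F n $ i)) $ i) sequentially"
    using eventually_gt_at_top[of i]
  proof eventually_elim
    case (elim M)
    have "(\<Sum>n<M. F n $ i) = (\<Sum>n\<le>i. F n $ i)"
      by (rule sum.mono_neutral_right) (use elim assms in auto)
    then show ?case
      by (simp add: fps_sum_nth)
  qed
qed

text \<open>Used to replace an infinite product or series by a truncation that agrees up to the
  coefficient in question.\<close>

lemma fps_mult_nth_cong_right:
  assumes "\<And>j. j \<le> i \<Longrightarrow> f $ j = g $ j"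
  shows "(h * f) $ i = (h * g) $ i"
  by (simp add: fps_mult_nth assms)

text \<open>The sum over n \<ge> k is indexed from 0 by the shift \<open>n + k\<close>. Summability
  is asserted as well, since \<open>suminf\<close> is informative only for a convergent
  series.\<close>

theorem theorem4p2:
  fixes k :: nat
  assumes "k \<ge> 1"
  shows "summable (\<lambda>n. qbinomial fps_X (n + k - 1) (k - 1) *
                       (qpochhammer_inf (fps_X ^ (n + k)) fps_X - 1)) \<and>
         Abs_fps (\<lambda>n. \<Sum>\<pi> \<in> {\<pi> \<in> distinct_partitions n. card \<pi> \<ge> k}.
            (- 1) ^ card \<pi> * (real (smallest_part k \<pi>) - real (smallest_part (k - 1) \<pi>))) =
         (- 1) ^ (k - 1) * fps_X ^ (k * (k - 1) div 2) *
         (\<Sum>n. qbinomial fps_X (n + k - 1) (k - 1) *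
                (qpochhammer_inf (fps_X ^ (n + k)) fps_X - 1))"
proof -
  let ?F = "\<lambda>n. qbinomial fps_X (n + k - 1) (k - 1) *
      (qpochhammer_inf (fps_X ^ (n + k)) fps_X - 1)"
  let ?c = "(- 1) ^ (k - 1) * fps_X ^ (k * (k - 1) div 2) :: real fps"
  let ?P = "\<lambda>m N. \<Prod>j\<in>{m..N}. 1 - fps_X ^ j :: real fps"
  have inf_nth: "(qpochhammer_inf (fps_X ^ (n + k)) fps_X - 1) $ i = (?P (n + k) N - 1) $ i"
    if "i \<le> N" for n i N
    using qpochhammer_inf_fps_X_nth[of "n + k" i N] that assms by simp
  \<comment> \<open>Truncated at i < n, the product over \<open>{n + k..i}\<close> is empty, so
    subtracting 1 leaves 0.\<close>
  have F_zero: "?F n $ i = 0" if "i < n" for n i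
  proof -
    have "?F n $ i = (qbinomial fps_X (n + k - 1) (k - 1) * (?P (n + k) i - 1)) $ i"
      by (intro fps_mult_nth_cong_right inf_nth)
    then show ?thesis
      using that by simp
  qed
  have sums: "?F sums Abs_fps (\<lambda>i. (\<Sum>n\<le>i. ?F n $ i))"
    using F_zero by (rule fps_sums_nth)
  have suminf_nth: "(\<Sum>n. ?F n) $ i = (\<Sum>n\<le>N. ?F n) $ i" if "i \<le> N" for i N
  proof -
    have "(\<Sum>n\<le>i. ?F n $ i) = (\<Sum>n\<le>N. ?F n $ i)"
      by (rule sum.mono_neutral_left) (use that F_zero in auto)
    then show ?thesis
      using sums_unique[OF sums, symmetric] by (simp add: fps_sum_nth)
  qed
  have "(?c * (\<Sum>n. ?F n)) $ N = (\<Sum>\<pi> \<in> {\<pi> \<in> distinct_partitions N. card \<pi> \<ge> k}.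
      (- 1) ^ card \<pi> * (real (smallest_part k \<pi>) - real (smallest_part (k - 1) \<pi>)))" for N
  proof -
    let ?D = "{\<pi> \<in> distinct_partitions N. card \<pi> \<ge> k}"
    let ?Q = "\<lambda>n \<pi>. card {x \<in> \<pi>. x < n + k} = k - 1"
    have D_sub: "\<pi> \<subseteq> {1..N}" if "\<pi> \<in> distinct_partitions N" for \<pi>
    proof
      fix x assume x: "x \<in> \<pi>"
      then have "x \<le> \<Sum>\<pi>"
        using that member_le_sum[of x \<pi> "\<lambda>x. x"] by (simp add: distinct_partitions_def)
      then show "x \<in> {1..N}"
        using that x by (cases x) (auto simp: distinct_partitions_def)
    qed
    \<comment> \<open>The n-th term collects the signs of those partitions for which m = n + k is a
      cut point.\<close>
    have coeff: "(?c * ?F n) $ N = (\<Sum>\<pi> | \<pi> \<in> ?D \<and> ?Q n \<pi>. (- 1) ^ card \<pi>)" for n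
    proof -
      let ?R = "{\<pi>. \<pi> \<subseteq> {1..max N (n + k - 1)} \<and> k \<le> card \<pi> \<and> ?Q n \<pi>}"
      \<comment> \<open>The prefactor of the theorem is the weight of the lightest (k -
        1)-subset.\<close>
      have "k * (k - 1) div 2 = (k - 1) * (k - 1 + 1) div 2"
        using assms by (simp add: mult.commute)
      then have "?c * qbinomial fps_X (n + k - 1) (k - 1) =
        (- 1) ^ (k - 1) * (\<Sum>A | A \<subseteq> {1..n + k - 1} \<and> card A = k - 1. fps_X ^ \<Sum>A)"
        by (simp only: sum_subsets_eq_qbinomial mult.assoc)
      then have "?c * qbinomial fps_X (n + k - 1) (k - 1) * (?P (n + k) N - 1) =
        (\<Sum>A | A \<subseteq> {1..n + k - 1} \<and> card A = k - 1. fps_X ^ \<Sum>A) *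
        (?P (n + k) N - 1) * (- 1) ^ (k - 1)"
        by (simp only: mult_ac)
      also have "\<dots> = (\<Sum>\<pi>\<in>?R. (- 1) ^ card \<pi> * fps_X ^ \<Sum>\<pi>)"
        by (rule sum_split_at) (use assms in auto)
      finally have "?c * qbinomial fps_X (n + k - 1) (k - 1) * (?P (n + k) N - 1) =
        (\<Sum>\<pi>\<in>?R. (- 1) ^ card \<pi> * fps_X ^ \<Sum>\<pi>)" .
      moreover have "(?c * ?F n) $ N =
        (?c * qbinomial fps_X (n + k - 1) (k - 1) * (?P (n + k) N - 1)) $ N"
        unfolding mult.assoc[symmetric] by (intro fps_mult_nth_cong_right inf_nth)
      ultimately have "(?c * ?F n) $ N = (\<Sum>\<pi>\<in>?R. ((- 1) ^ card \<pi> * fps_X ^ \<Sum>\<pi>) $ N)"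
        by (simp add: fps_sum_nth)
      also have "\<dots> = (\<Sum>\<pi>\<in>?R. if \<Sum>\<pi> = N then (- 1) ^ card \<pi> else 0)"
      proof (rule sum.cong)
        fix \<pi> :: "nat set"
        show "((- 1) ^ card \<pi> * fps_X ^ \<Sum>\<pi>) $ N = (if \<Sum>\<pi> = N then (- 1) ^ card \<pi> else 0 :: real)"
          by (cases "even (card \<pi>)") auto
      qed simp
      also have "\<dots> = (\<Sum>\<pi> | \<pi> \<in> ?R \<and> \<Sum>\<pi> = N. (- 1) ^ card \<pi>)"
        by (rule sum.inter_filter[symmetric])
           (rule finite_subset[of _ "Pow {1..max N (n + k - 1)}"], auto)
      \<comment> \<open>The explicit bound on the parts is absorbed, as no part of a partition of N
        exceeds N.\<close>
      also have "{\<pi>. \<pi> \<in> ?R \<and> \<Sum>\<pi> = N} = {\<pi>. \<pi> \<in> ?D \<and> ?Q n \<pi>}"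
      proof (intro equalityI subsetI)
        fix \<pi> assume "\<pi> \<in> {\<pi>. \<pi> \<in> ?R \<and> \<Sum>\<pi> = N}"
        then show "\<pi> \<in> {\<pi>. \<pi> \<in> ?D \<and> ?Q n \<pi>}"
          by (auto simp: distinct_partitions_def dest: finite_subset)
      next
        fix \<pi> assume "\<pi> \<in> {\<pi>. \<pi> \<in> ?D \<and> ?Q n \<pi>}"
        moreover from this have "\<pi> \<subseteq> {1..max N (n + k - 1)}"
          using D_sub[of \<pi>] by (auto simp: le_max_iff_disj)
        ultimately show "\<pi> \<in> {\<pi>. \<pi> \<in> ?R \<and> \<Sum>\<pi> = N}"
          by (simp add: distinct_partitions_def)
      qed
      finally show ?thesis .
    qed
    have finD: "finite ?D"
      using finite_distinct_partitions by simp
    have "(?c * (\<Sum>n. ?F n)) $ N = (?c * (\<Sum>n\<le>N. ?F n)) $ N"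
      by (intro fps_mult_nth_cong_right suminf_nth)
    also have "\<dots> = (\<Sum>n\<le>N. (?c * ?F n) $ N)"
      by (simp only: sum_distrib_left fps_sum_nth)
    also have "\<dots> = (\<Sum>n\<le>N. \<Sum>\<pi> | \<pi> \<in> ?D \<and> ?Q n \<pi>. (- 1) ^ card \<pi>)"
      by (simp only: coeff)
    \<comment> \<open>After the exchange each partition contributes its sign once per cut point,
      which gives the gap as its multiplicity.\<close>
    also have "\<dots> = (\<Sum>\<pi>\<in>?D. \<Sum>n | n \<in> {..N} \<and> ?Q n \<pi>. (- 1) ^ card \<pi>)"
      using finD by (intro sum.swap_restrict) auto
    also have "\<dots> = (\<Sum>\<pi>\<in>?D. (- 1) ^ card \<pi> *
        (real (smallest_part k \<pi>) - real (smallest_part (k - 1) \<pi>)))"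
    proof (rule sum.cong)
      fix \<pi> assume "\<pi> \<in> ?D"
      then have "real (smallest_part k \<pi>) - real (smallest_part (k - 1) \<pi>) =
          real (card {n \<in> {..N}. ?Q n \<pi>})"
        using assms D_sub by (intro smallest_part_diff_eq_card) auto
      then show "(\<Sum>n | n \<in> {..N} \<and> ?Q n \<pi>. (- 1) ^ card \<pi>) =
          (- 1) ^ card \<pi> * (real (smallest_part k \<pi>) - real (smallest_part (k - 1) \<pi>))"
        by (simp add: mult.commute)
    qed simp
    finally show ?thesis .
  qed
  then show ?thesis
    using sums by (auto simp: sums_iff fps_eq_iff)
qed

end
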